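(* Let $k$ be a field with $\operatorname{char}(k)\neq 2,3$, and let $\Pi=\{\{A_1,A_2,A_3\},\{B_1,B_2,B_3\}\}$ be a Pappus structure in the projective plane $\mathbb{P}^2$ over $k$ with $\mathrm{sig}(\Pi)=[x,y]$. If $x\neq y$, then $\mathrm{leisen}(\Pi)$ is a Pappus structure (in the dual plane $(\mathbb{P}^2)^\vee$). Moreover, it is equivalent to the structure $\mathrm{steiner}(\Pi)$.
   Context: Cross-ratio: for four points of $\mathbb{P}^1$, $\langle x_1,x_2,x_3,x_4\rangle=\frac{(x_1-x_3)(x_2-x_4)}{(x_2-x_3)(x_1-x_4)}$; for four collinear points of a projective plane, use any projective isomorphism of their line with $\mathbb{P}^1$. Put $j(r)=\frac{4(r^2-r+1)^3}{27r^2(r-1)^2}$ for $r\ne 0,1$. Pappus structure: an unordered pair of sets of points $\{\{A_1,A_2,A_3\},\{B_1,B_2,B_3\}\}$ in a projective plane over $k$ such that the six points are pairwise distinct, the three points in each set are collinear, the line containing the first three differs from the line containing the other three, and the intersection point $P$ of the two lines is different from all six points. Signature: with $r=\langle A_1,A_2,A_3,P\rangle$ and $s=\langle B_1,B_2,B_3,P\rangle$, $\mathrm{sig}(\Pi)=[\,j(r)+j(s),\ j(r)j(s)\,]$. Equivalence: two Pappus structures $\Pi_1,\Pi_2$ in planes $\mathbb{P}^2_{(1)},\mathbb{P}^2_{(2)}$ are equivalent if there is a projective linear isomorphism $\mathbb{P}^2_{(1)}\to\mathbb{P}^2_{(2)}$ over $k$ carrying $\Pi_1$ to $\Pi_2$.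 Pappus lines: for $\sigma\in\mathfrak{S}_3$, $\Lambda_\sigma$ is the line containing the three points $A_iB_{\sigma(j)}\cap A_jB_{\sigma(i)}$ for $(i,j)=(1,2),(2,3),(1,3)$ (collinear by Pappus's theorem). Define $$\mathrm{steiner}(\Pi)=\{\{\Lambda_e,\Lambda_{(1\,2\,3)},\Lambda_{(1\,3\,2)}\},\{\Lambda_{(1\,2)},\Lambda_{(1\,3)},\Lambda_{(2\,3)}\}\},$$ regarded as consisting of points of $(\mathbb{P}^2)^\vee$; for $x\neq y$ this is a Pappus structure. Leisenring lines: for the array with rows $A_1,A_2,A_3$ and $B_1,B_2,B_3$, and for $\{i,j,l\}=\{1,2,3\}$, put $Q_i=A_jB_l\cap A_lB_j$ and $R_i=PQ_i\cap A_iB_i$. Leisenring's theorem says $R_1,R_2,R_3$ are collinear; the line containing them is the Leisenring line of the array. For $\sigma\in\mathfrak{S}_3$, $\Psi_\sigma$ is the Leisenring line of the array with rows $A_1,A_2,A_3$ and $B_{\sigma(1)},B_{\sigma(2)},B_{\sigma(3)}$. By a theorem of Rigby the three $\Psi_\sigma$ with $\sigma$ even are concurrent, as are the three with $\sigma$ odd. Define $$\mathrm{leisen}(\Pi)=\{\{\Psi_e,\Psi_{(1\,2\,3)},\Psi_{(1\,3\,2)}\},\{\Psi_{(1\,2)},\Psi_{(2\,3)},\Psi_{(1\,3)}\}\},$$ regarded as consisting of points of $(\mathbb{P}^2)^\vee$. *)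

theory Defs
  imports "HOL-Analysis.Analysis" "HOL-Combinatorics.Cycles"
begin

(* P(k^n) is the set of 1-dimensional subspaces of k^n; its lines are the 2-dimensional subspaces,
   incidence is inclusion, and the intersection point of two distinct coplanar lines is the
   intersection of the two subspaces. *)

definition proj_point :: "('a::field ^ 'n) set \<Rightarrow> bool" where
  "proj_point p \<longleftrightarrow> vec.subspace p \<and> vec.dim p = 1"

definition proj_line :: "('a::field ^ 'n) set \<Rightarrow> bool" where
  "proj_line L \<longleftrightarrow> vec.subspace L \<and> vec.dim L = 2"

definition join :: "('a::field ^ 'n) set \<Rightarrow> ('a ^ 'n) set \<Rightarrow> ('a ^ 'n) set" where
  "join p q = vec.span (p \<union> q)"

(* The dual space of k^3 is written in the basis dual to the standard one: a vector phi stands for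
   the functional v |-> scalar_product phi v, so (P^2)^dual is again the projective plane of k^3.
   As a point of it, the line L is the set of functionals that vanish on L. *)

definition dual_point :: "('a::field ^ 'n) set \<Rightarrow> ('a ^ 'n) set" where
  "dual_point L = {\<phi>. \<forall>v\<in>L. scalar_product \<phi> v = 0}"

(* det2 [x, 1] [x', 1] = x - x', and the cross-ratio below does not depend on the scaling of the
   representatives u_i, so it is the usual one; with homogeneous coordinates one of the points may
   also be the point at infinity. *)

definition det2 :: "'a::field ^ 2 \<Rightarrow> 'a ^ 2 \<Rightarrow> 'a" where
  "det2 u v = u $ 1 * v $ 2 - u $ 2 * v $ 1"

definition cross_ratio_P1 ::
  "('a::field ^ 2) set \<Rightarrow> ('a ^ 2) set \<Rightarrow> ('a ^ 2) set \<Rightarrow> ('a ^ 2) set \<Rightarrow> 'a" where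
  "cross_ratio_P1 X1 X2 X3 X4 =
    (THE r. \<exists>u1 u2 u3 u4.
      X1 = vec.span {u1} \<and> X2 = vec.span {u2} \<and> X3 = vec.span {u3} \<and> X4 = vec.span {u4} \<and>
      r = (det2 u1 u3 * det2 u2 u4) / (det2 u2 u3 * det2 u1 u4))"

(* An injective linear map f from k^2 to k^3 is a projective isomorphism of P^1 with the line
   range f. *)

definition cross_ratio ::
  "('a::field ^ 3) set \<Rightarrow> ('a ^ 3) set \<Rightarrow> ('a ^ 3) set \<Rightarrow> ('a ^ 3) set \<Rightarrow> 'a" where
  "cross_ratio p1 p2 p3 p4 =
    (THE r. \<exists>(f :: 'a ^ 2 \<Rightarrow> 'a ^ 3) X1 X2 X3 X4.
      Vector_Spaces.linear (*s) (*s) f \<and> inj f \<and>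
      proj_point X1 \<and> proj_point X2 \<and> proj_point X3 \<and> proj_point X4 \<and>
      p1 = f ` X1 \<and> p2 = f ` X2 \<and> p3 = f ` X3 \<and> p4 = f ` X4 \<and>
      r = cross_ratio_P1 X1 X2 X3 X4)"

definition j_fun :: "'a::field \<Rightarrow> 'a" where
  "j_fun r = (4 * (r\<^sup>2 - r + 1) ^ 3) / (27 * r\<^sup>2 * (r - 1)\<^sup>2)"

definition pappus_structure :: "('a::field ^ 3) set set set \<Rightarrow> bool" where
  "pappus_structure S \<longleftrightarrow>
    (\<exists>A1 A2 A3 B1 B2 B3 L M.
      S = {{A1, A2, A3}, {B1, B2, B3}} \<and>
      (\<forall>p \<in> {A1, A2, A3, B1, B2, B3}. proj_point p) \<and>
      distinct [A1, A2, A3, B1, B2, B3] \<and>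
      proj_line L \<and> A1 \<subseteq> L \<and> A2 \<subseteq> L \<and> A3 \<subseteq> L \<and>
      proj_line M \<and> B1 \<subseteq> M \<and> B2 \<subseteq> M \<and> B3 \<subseteq> M \<and>
      L \<noteq> M \<and> L \<inter> M \<notin> {A1, A2, A3, B1, B2, B3})"

(* A structure {{A 1, A 2, A 3}, {B 1, B 2, B 3}} is labelled by functions A and B, of which only
   the values at 1, 2, 3 matter. *)

definition center :: "(nat \<Rightarrow> ('a::field ^ 3) set) \<Rightarrow> (nat \<Rightarrow> ('a ^ 3) set) \<Rightarrow> ('a ^ 3) set" where
  "center A B = join (A 1) (A 2) \<inter> join (B 1) (B 2)"

definition sig :: "(nat \<Rightarrow> ('a::field ^ 3) set) \<Rightarrow> (nat \<Rightarrow> ('a ^ 3) set) \<Rightarrow> 'a \<times> 'a" where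
  "sig A B =
    (let r = cross_ratio (A 1) (A 2) (A 3) (center A B);
         s = cross_ratio (B 1) (B 2) (B 3) (center A B)
     in (j_fun r + j_fun s, j_fun r * j_fun s))"

definition pappus_line ::
  "(nat \<Rightarrow> ('a::field ^ 3) set) \<Rightarrow> (nat \<Rightarrow> ('a ^ 3) set) \<Rightarrow> (nat \<Rightarrow> nat) \<Rightarrow> ('a ^ 3) set" where
  "pappus_line A B \<sigma> =
    (THE L. proj_line L \<and>
      (\<forall>(i, j) \<in> {(1, 2), (2, 3), (1, 3)}.
        join (A i) (B (\<sigma> j)) \<inter> join (A j) (B (\<sigma> i)) \<subseteq> L))"

definition leisenring_line ::
  "(nat \<Rightarrow> ('a::field ^ 3) set) \<Rightarrow> (nat \<Rightarrow> ('a ^ 3) set) \<Rightarrow> ('a ^ 3) set" where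
  "leisenring_line A B =
    (let Q = (\<lambda>j l. join (A j) (B l) \<inter> join (A l) (B j));
         R = (\<lambda>i j l. join (center A B) (Q j l) \<inter> join (A i) (B i))
     in THE L. proj_line L \<and> R 1 2 3 \<subseteq> L \<and> R 2 3 1 \<subseteq> L \<and> R 3 1 2 \<subseteq> L)"

(* cycle_of_list [1, 2, 3] is the permutation 1 |-> 2 |-> 3 |-> 1. *)

definition steiner ::
  "(nat \<Rightarrow> ('a::field ^ 3) set) \<Rightarrow> (nat \<Rightarrow> ('a ^ 3) set) \<Rightarrow> ('a ^ 3) set set set" where
  "steiner A B =
    (let \<Lambda> = (\<lambda>\<sigma>. dual_point (pappus_line A B \<sigma>))
     in {{\<Lambda> id, \<Lambda> (cycle_of_list [1, 2, 3]), \<Lambda> (cycle_of_list [1, 3, 2])},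
         {\<Lambda> (cycle_of_list [1, 2]), \<Lambda> (cycle_of_list [1, 3]), \<Lambda> (cycle_of_list [2, 3])}})"

definition leisen ::
  "(nat \<Rightarrow> ('a::field ^ 3) set) \<Rightarrow> (nat \<Rightarrow> ('a ^ 3) set) \<Rightarrow> ('a ^ 3) set set set" where
  "leisen A B =
    (let \<Psi> = (\<lambda>\<sigma>. dual_point (leisenring_line A (B \<circ> \<sigma>)))
     in {{\<Psi> id, \<Psi> (cycle_of_list [1, 2, 3]), \<Psi> (cycle_of_list [1, 3, 2])},
         {\<Psi> (cycle_of_list [1, 2]), \<Psi> (cycle_of_list [2, 3]), \<Psi> (cycle_of_list [1, 3])}})"

(* A projective linear isomorphism is one induced by a linear bijection. *)

definition pappus_equivalent ::
  "('a::field ^ 3) set set set \<Rightarrow> ('a ^ 3) set set set \<Rightarrow> bool" where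
  "pappus_equivalent S1 S2 \<longleftrightarrow>
    pappus_structure S1 \<and> pappus_structure S2 \<and>
    (\<exists>f :: 'a ^ 3 \<Rightarrow> 'a ^ 3. Vector_Spaces.linear (*s) (*s) f \<and> bij f \<and>
      S2 = (\<lambda>T. (\<lambda>p. f ` p) ` T) ` S1)"

end

theory Submission
  imports Defs
begin

text \<open>
  Let p span the intersection of the two lines. Since 3 is invertible, vectors u and v on the two
  lines can be chosen so that A_i is spanned by u + a_i p and B_i by v + b_i p, where
  a_1 + a_2 + a_3 = 0 and b_1 + b_2 + b_3 = 0. In the basis dual to (u, v, p) the Pappus
  lines are then explicit vectors (X, Y, Z), and the corresponding Leisenring lines turn out to be
  (- 2 X, - 2 Y, Z). Hence the linear map diag(1, 1, - 2) carries one structure to the other.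

  For either structure the three vectors of each parity add up to 0, and every determinant
  of one vector of one parity and two of the other is, up to nonzero factors, one of the six
  sums a_1 b_i + a_2 b_j + a_3 b_k. Twice the product of the three even (odd) ones is
  27 e e' + d d' (respectively 27 e e' - d d'), where e, e' are the products and d, d' the
  products of differences of the a_i and the b_i. Since j(r) - 1 = 27 e^2 / d^2, these sums are
  all nonzero exactly when x and y differ.
\<close>

section \<open>Linear algebra of the projective plane\<close>

text \<open>Over any field this formula serves both directions of duality: applied to two points it
  gives the covector of their join, applied to two covectors the meet of their lines.\<close>

definition cross_prod :: "'a::field ^ 3 \<Rightarrow> 'a ^ 3 \<Rightarrow> 'a ^ 3" where
  "cross_prod x y =
    vector [x$2 * y$3 - x$3 * y$2, x$3 * y$1 - x$1 * y$3, x$1 * y$2 - x$2 * y$1]"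

text \<open>For nonzero \<open>n\<close> this is the line with homogeneous coordinates
  \<open>n\<close>.\<close>

definition orth :: "'a::field ^ 3 \<Rightarrow> ('a ^ 3) set" where
  "orth n = {v. scalar_product n v = 0}"

lemma cross_prod_nth [simp]:
  "cross_prod x y $ 1 = x$2 * y$3 - x$3 * y$2"
  "cross_prod x y $ 2 = x$3 * y$1 - x$1 * y$3"
  "cross_prod x y $ 3 = x$1 * y$2 - x$2 * y$1"
  by (simp_all add: cross_prod_def)

lemma scalar_product_3: "scalar_product x (y :: 'a::field ^ 3) = x$1 * y$1 + x$2 * y$2 + x$3 * y$3"
  by (simp add: scalar_product_def sum_3)

lemma vec3_eq_iff: "x = (y :: 'a ^ 3) \<longleftrightarrow> x$1 = y$1 \<and> x$2 = y$2 \<and> x$3 = y$3"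
  by (simp add: vec_eq_iff forall_3)

lemma in_span_pair: "v \<in> vec.span {x, y} \<longleftrightarrow> (\<exists>a b. v = a *s x + b *s y)"
  for x :: "'a::field ^ 'n"
proof -
  have "v \<in> vec.span {x, y} \<longleftrightarrow> (\<exists>a b. v - a *s x = b *s y)"
    by (auto simp: vec.span_breakdown_eq vec.span_singleton)
  thus ?thesis by (simp add: diff_eq_eq add.commute)
qed

lemma span_scale:
  fixes x :: "'a::field ^ 'n"
  assumes "c \<noteq> 0"
  shows "vec.span {c *s x} = vec.span {x}"
proof -
  have "x = (1 / c) *s (c *s x)" using assms by (simp add: vec_eq_iff)
  hence "x \<in> vec.span {c *s x}"
    by (metis insertI1 vec.span_base vec.span_scale)
  moreover have "c *s x \<in> vec.span {x}"
    by (simp add: vec.span_base vec.span_scale)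
  ultimately show ?thesis
    by (intro subset_antisym vec.span_minimal vec.subspace_span) simp_all
qed

lemma span_singleton_eqD:
  fixes x y :: "'a::field ^ 'n"
  assumes "vec.span {x} = vec.span {y}" "y \<noteq> 0"
  shows "\<exists>c. c \<noteq> 0 \<and> x = c *s y"
proof -
  have "x \<in> vec.span {y}" "y \<in> vec.span {x}"
    using assms(1) vec.span_base[of x "{x}"] vec.span_base[of y "{y}"] by auto
  then obtain c d where cd: "x = c *s y" "y = d *s x"
    unfolding vec.span_singleton by blast
  hence "c \<noteq> 0" using assms(2) by (intro notI) simp
  thus ?thesis using cd(1) by blast
qed

lemma proj_point_iff: "proj_point q \<longleftrightarrow> (\<exists>x. x \<noteq> 0 \<and> q = vec.span {x})" for q :: "('a::field ^ 'n) set"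
proof
  assume q: "proj_point q"
  obtain S where S: "S \<subseteq> q" "vec.independent S" "q \<subseteq> vec.span S" "card S = vec.dim q"
    using vec.basis_exists by blast
  have "card S = 1" using S q by (simp add: proj_point_def)
  then obtain x where x: "S = {x}" by (auto simp: card_1_singleton_iff)
  have "x \<noteq> 0" using S(2) x vec.dependent_zero by blast
  moreover have "q = vec.span {x}"
    using S x q vec.span_minimal[of S q] by (auto simp: proj_point_def)
  ultimately show "\<exists>x. x \<noteq> 0 \<and> q = vec.span {x}" by blast
next
  assume "\<exists>x. x \<noteq> 0 \<and> q = vec.span {x}"
  then obtain x where "x \<noteq> 0" "q = vec.span {x}" by blast
  thus "proj_point q"
    by (simp add: proj_point_def vec.dim_eq_card_independent)
qed

lemma proj_point_span: "x \<noteq> 0 \<Longrightarrow> proj_point (vec.span {x})"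
  using proj_point_iff by blast

section \<open>Joins and meets as cross products\<close>

lemma cross_prod_eq_0:
  fixes x y :: "'a::field ^ 3"
  assumes "cross_prod x y = 0" "y \<noteq> 0"
  shows "\<exists>c. x = c *s y"
proof -
  have e: "x$2 * y$3 = x$3 * y$2" "x$3 * y$1 = x$1 * y$3" "x$1 * y$2 = x$2 * y$1"
    using assms(1) by (simp_all add: vec3_eq_iff)
  consider "y$1 \<noteq> 0" | "y$2 \<noteq> 0" | "y$3 \<noteq> 0" using assms(2) by (auto simp: vec3_eq_iff)
  thus ?thesis
  proof cases
    case 1 thus ?thesis using e by (intro exI[of _ "x$1 / y$1"]) (simp add: vec3_eq_iff field_simps)
  next
    case 2 thus ?thesis using e by (intro exI[of _ "x$2 / y$2"]) (simp add: vec3_eq_iff field_simps)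
  next
    case 3 thus ?thesis using e by (intro exI[of _ "x$3 / y$3"]) (simp add: vec3_eq_iff field_simps)
  qed
qed

lemma cross_prod_nonzero:
  fixes x y :: "'a::field ^ 3"
  assumes "x \<noteq> 0" "y \<noteq> 0" "vec.span {x} \<noteq> vec.span {y}"
  shows "cross_prod x y \<noteq> 0"
proof
  assume "cross_prod x y = 0"
  then obtain c where c: "x = c *s y" using cross_prod_eq_0 assms(2) by blast
  hence "c \<noteq> 0" using assms(1) by auto
  thus False using assms(3) c span_scale by blast
qed

lemma span_pair_eq_orth:
  fixes x y :: "'a::field ^ 3"
  assumes "cross_prod x y \<noteq> 0"
  shows "vec.span {x, y} = orth (cross_prod x y)"
proof (intro set_eqI iffI)
  fix v assume "v \<in> vec.span {x, y}"
  then obtain a b where "v = a *s x + b *s y" by (auto simp: in_span_pair)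
  thus "v \<in> orth (cross_prod x y)"
    by (simp add: orth_def scalar_product_3 algebra_simps)
next
  fix v assume "v \<in> orth (cross_prod x y)"
  hence v: "scalar_product (cross_prod x y) v = 0" by (simp add: orth_def)
  have "\<exists>w. scalar_product (cross_prod x y) w \<noteq> 0"
  proof -
    obtain i where "cross_prod x y $ i \<noteq> 0" using assms by (auto simp: vec_eq_iff)
    hence "scalar_product (cross_prod x y) (axis i 1) \<noteq> 0"
      by (simp add: scalar_product_def axis_def if_distrib cong: if_cong)
    thus ?thesis ..
  qed
  then obtain w where w: "scalar_product (cross_prod x y) w \<noteq> 0" ..
  \<comment> \<open>Cramer's rule, with the determinants written as triple products; for
    \<open>v\<close> in the plane the coefficient of \<open>w\<close> vanishes.\<close>
  have "scalar_product (cross_prod x y) w *s v =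
    scalar_product (cross_prod v y) w *s x + scalar_product (cross_prod x v) w *s y
      + scalar_product (cross_prod x y) v *s w"
    by (simp add: vec3_eq_iff scalar_product_3 algebra_simps)
  hence "v = (scalar_product (cross_prod v y) w / scalar_product (cross_prod x y) w) *s x
      + (scalar_product (cross_prod x v) w / scalar_product (cross_prod x y) w) *s y"
    using v w by (simp add: vec3_eq_iff field_simps)
  thus "v \<in> vec.span {x, y}" by (auto simp: in_span_pair)
qed

lemma orth_Int_orth:
  fixes n m :: "'a::field ^ 3"
  assumes "cross_prod n m \<noteq> 0"
  shows "orth n \<inter> orth m = vec.span {cross_prod n m}"
proof (intro set_eqI iffI)
  fix v assume "v \<in> orth n \<inter> orth m"
  hence v: "scalar_product n v = 0" "scalar_product m v = 0" by (simp_all add: orth_def)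
  \<comment> \<open>Expansion of the vector triple product: a vector killed by both covectors is
    parallel to \<open>cross_prod n m\<close>.\<close>
  have "cross_prod v (cross_prod n m) = scalar_product m v *s n - scalar_product n v *s m"
    by (simp add: vec3_eq_iff scalar_product_3 algebra_simps)
  with v have "cross_prod v (cross_prod n m) = 0" by simp
  with assms show "v \<in> vec.span {cross_prod n m}"
    using cross_prod_eq_0 by (fastforce simp: vec.span_singleton)
next
  fix v assume "v \<in> vec.span {cross_prod n m}"
  thus "v \<in> orth n \<inter> orth m"
    by (auto simp: vec.span_singleton orth_def scalar_product_3 algebra_simps)
qed

lemma orth_scale: "c \<noteq> 0 \<Longrightarrow> orth (c *s n) = orth n"
proof -
  assume "c \<noteq> 0"
  have "scalar_product (c *s n) v = c * scalar_product n v" for v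
    by (simp add: scalar_product_3 algebra_simps)
  with \<open>c \<noteq> 0\<close> show ?thesis by (simp add: orth_def)
qed

text \<open>Turns the annihilators in \<open>steiner\<close> and \<open>leisen\<close> into one
  explicit spanning vector per line.\<close>

lemma dual_point_orth:
  fixes n :: "'a::field ^ 3"
  assumes "n \<noteq> 0"
  shows "dual_point (orth n) = vec.span {n}"
proof (intro set_eqI iffI)
  fix \<phi> assume "\<phi> \<in> dual_point (orth n)"
  hence \<phi>: "scalar_product \<phi> v = 0" if "scalar_product n v = 0" for v
    using that by (auto simp: dual_point_def orth_def)
  \<comment> \<open>The vector \<open>cross_prod n w\<close> is killed by \<open>n\<close>, hence by
    \<open>\<phi>\<close>, and a triple product is invariant under cyclic shifts.\<close>
  have "scalar_product (cross_prod \<phi> n) w = 0" for w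
    using \<phi>[of "cross_prod n w"] by (simp add: scalar_product_3 algebra_simps)
  from this[of "axis 1 1"] this[of "axis 2 1"] this[of "axis 3 1"]
  have "cross_prod \<phi> n = 0"
    by (simp add: vec3_eq_iff scalar_product_3 axis_def)
  thus "\<phi> \<in> vec.span {n}"
    using cross_prod_eq_0 assms by (fastforce simp: vec.span_singleton)
next
  fix \<phi> assume "\<phi> \<in> vec.span {n}"
  then obtain c where "\<phi> = c *s n" by (auto simp: vec.span_singleton)
  moreover have "scalar_product (c *s n) v = c * scalar_product n v" for v
    by (simp add: scalar_product_3 algebra_simps)
  ultimately show "\<phi> \<in> dual_point (orth n)"
    by (auto simp: dual_point_def orth_def)
qed

lemma join_span: "join (vec.span {x}) (vec.span {y}) = vec.span {x, y}"
proof -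
  have "vec.span (vec.span {x} \<union> vec.span {y}) = vec.span ({x} \<union> {y})"
    by (simp only: vec.span_Un vec.span_span)
  thus ?thesis by (simp add: join_def insert_commute)
qed

lemma proj_line_span:
  fixes x y :: "'a::field ^ 3"
  assumes "cross_prod x y \<noteq> 0"
  shows "proj_line (vec.span {x, y})"
proof -
  have "x \<noteq> 0" "y \<noteq> 0" using assms by (auto simp: vec3_eq_iff)
  have ind: "vec.independent {x, y}"
    using assms \<open>y \<noteq> 0\<close>
    by (auto simp: vec.independent_insert vec.span_singleton vec3_eq_iff)
  have "x \<noteq> y" using assms by (auto simp: vec3_eq_iff)
  hence "vec.dim (vec.span {x, y}) = 2"
    using vec.dim_eq_card_independent[OF ind] by simp
  thus ?thesis by (simp add: proj_line_def)
qed

lemma proj_line_eq_span: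
  fixes x y :: "'a::field ^ 3"
  assumes "proj_line L" "x \<in> L" "y \<in> L" "cross_prod x y \<noteq> 0"
  shows "L = vec.span {x, y}"
proof -
  have "vec.span {x, y} \<subseteq> L"
    using assms by (intro vec.span_minimal) (auto simp: proj_line_def)
  moreover have "vec.dim L \<le> vec.dim (vec.span {x, y})"
    using assms(1) proj_line_span[OF assms(4)] by (simp add: proj_line_def)
  ultimately show ?thesis
    using assms(1) proj_line_span[OF assms(4)] 
    by (metis proj_line_def vec.subspace_dim_equal)
qed

text \<open>Evaluates the definite descriptions in \<open>pappus_line\<close> and
  \<open>leisenring_line\<close>: two independent points force uniqueness, and only the incidence of
  the third remains to be checked.\<close>

lemma the_proj_line:
  fixes x y z :: "'a::field ^ 3"
  assumes "cross_prod x y \<noteq> 0" "z \<in> orth (cross_prod x y)"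
  shows "(THE L. proj_line L \<and> vec.span {x} \<subseteq> L \<and> vec.span {y} \<subseteq> L \<and> vec.span {z} \<subseteq> L)
    = orth (cross_prod x y)"
proof (rule the_equality)
  have "x \<in> vec.span {x, y}" "y \<in> vec.span {x, y}" "z \<in> vec.span {x, y}"
    using assms span_pair_eq_orth by (auto intro: vec.span_base)
  thus "proj_line (orth (cross_prod x y)) \<and> vec.span {x} \<subseteq> orth (cross_prod x y) \<and>
      vec.span {y} \<subseteq> orth (cross_prod x y) \<and> vec.span {z} \<subseteq> orth (cross_prod x y)"
    unfolding span_pair_eq_orth[OF assms(1), symmetric]
    by (simp add: proj_line_span[OF assms(1)] vec.span_minimal)
next
  fix L assume "proj_line L \<and> vec.span {x} \<subseteq> L \<and> vec.span {y} \<subseteq> L \<and> vec.span {z} \<subseteq> L"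
  hence "proj_line L" "x \<in> L" "y \<in> L" using vec.span_base by blast+
  thus "L = orth (cross_prod x y)"
    using proj_line_eq_span assms(1) span_pair_eq_orth by blast
qed

lemma cross_prod_0 [simp]: "cross_prod 0 y = 0" "cross_prod x 0 = 0"
  by (simp_all add: vec3_eq_iff)

lemma scalar_product_0 [simp]: "scalar_product 0 y = 0" "scalar_product x 0 = 0"
  by (simp_all add: scalar_product_def)

section \<open>Lines as zero sets of covectors\<close>

lemma proj_line_eq_orth:
  fixes L :: "('a::field ^ 3) set"
  assumes "proj_line L"
  obtains n where "n \<noteq> 0" "L = orth n"
proof -
  obtain S where S: "S \<subseteq> L" "vec.independent S" "L \<subseteq> vec.span S" "card S = vec.dim L"
    using vec.basis_exists by blast
  have "card S = 2" using S assms by (simp add: proj_line_def)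
  then obtain x y where xy: "S = {x, y}" "x \<noteq> y" by (auto simp: card_2_iff)
  have y: "y \<noteq> 0" using S(2) xy(1) vec.dependent_zero by blast
  have "cross_prod x y \<noteq> 0"
  proof
    assume "cross_prod x y = 0"
    then obtain c where "x = c *s y" using cross_prod_eq_0 y by blast
    hence "x \<in> vec.span {y}" by (simp add: vec.span_base vec.span_scale)
    thus False using S(2) xy by (simp add: vec.independent_insert)
  qed
  moreover have "L = vec.span {x, y}"
    using S xy assms vec.span_minimal[of S L] by (auto simp: proj_line_def)
  ultimately show thesis using that[of "cross_prod x y"] span_pair_eq_orth by blast
qed

lemma proj_lines_meet:
  fixes L M :: "('a::field ^ 3) set"
  assumes "proj_line L" "proj_line M" "L \<noteq> M"
  obtains p where "p \<noteq> 0" "L \<inter> M = vec.span {p}"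
proof -
  obtain n where n: "n \<noteq> 0" "L = orth n" using proj_line_eq_orth assms(1) by blast
  obtain m where m: "m \<noteq> 0" "M = orth m" using proj_line_eq_orth assms(2) by blast
  have "cross_prod n m \<noteq> 0"
  proof
    assume "cross_prod n m = 0"
    then obtain c where c: "n = c *s m" using cross_prod_eq_0 m(1) by blast
    hence "c \<noteq> 0" using n(1) by auto
    thus False using assms(3) n m c orth_scale by blast
  qed
  thus thesis using that[of "cross_prod n m"] orth_Int_orth n(2) m(2) by blast
qed

text \<open>Vectors with sum 0 are coplanar and their pairwise cross products agree up to sign, so
  one independent pair makes all three points distinct. The triple products say that no point of one
  triple lies on the line of the other; this separates the lines, the triples and the intersection
  point.\<close>

lemma pappus_structureI:
  fixes n1 n2 n3 m1 m2 m3 :: "'a::field ^ 3"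
  assumes n: "n1 + n2 + n3 = 0" and m: "m1 + m2 + m3 = 0"
    and nm: "\<And>x. x \<in> {n1, n2, n3} \<Longrightarrow> scalar_product (cross_prod m1 m2) x \<noteq> 0"
    and mn: "\<And>x. x \<in> {m1, m2, m3} \<Longrightarrow> scalar_product (cross_prod n1 n2) x \<noteq> 0"
  shows "pappus_structure {{vec.span {n1}, vec.span {n2}, vec.span {n3}},
    {vec.span {m1}, vec.span {m2}, vec.span {m3}}}"
proof -
  have n3: "n3 = - n1 - n2" and m3: "m3 = - m1 - m2"
    using n m by (simp_all add: eq_neg_iff_add_eq_0 algebra_simps)
  have cn: "cross_prod n1 n2 \<noteq> 0" and cm: "cross_prod m1 m2 \<noteq> 0"
    using nm[of n1] mn[of m1] by auto
  define L M where "L = vec.span {n1, n2}" and "M = vec.span {m1, m2}"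
  note LM = span_pair_eq_orth[OF cn, folded L_def] span_pair_eq_orth[OF cm, folded M_def]
  have L: "n1 \<in> L" "n2 \<in> L" "n3 \<in> L" and M: "m1 \<in> M" "m2 \<in> M" "m3 \<in> M"
    unfolding LM n3 m3 by (simp_all add: orth_def scalar_product_3 algebra_simps)
  have nM: "n1 \<notin> M" "n2 \<notin> M" "n3 \<notin> M" and mL: "m1 \<notin> L" "m2 \<notin> L" "m3 \<notin> L"
    using nm mn unfolding LM by (simp_all add: orth_def)
  have sub: "vec.subspace L" "vec.subspace M" by (simp_all add: L_def M_def)
  have span_sub: "vec.span {x} \<subseteq> T \<longleftrightarrow> x \<in> T" if "vec.subspace T" for x :: "'a ^ 3" and T
    using that vec.span_minimal[of "{x}" T] vec.span_base[of x "{x}"] by auto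
  have nz: "n1 \<noteq> 0" "n2 \<noteq> 0" "n3 \<noteq> 0" "m1 \<noteq> 0" "m2 \<noteq> 0" "m3 \<noteq> 0"
    using nM mL vec.subspace_0[OF sub(1)] vec.subspace_0[OF sub(2)] by auto
  have par: "vec.span {x} \<noteq> vec.span {y}" if "cross_prod x y \<noteq> 0" for x y :: "'a ^ 3"
  proof
    assume eq: "vec.span {x} = vec.span {y}"
    have "y \<noteq> 0" using that by (auto simp: vec3_eq_iff)
    then obtain c where "x = c *s y" using span_singleton_eqD[OF eq] by blast
    thus False using that by (simp add: vec3_eq_iff)
  qed
  have "cross_prod n1 n3 = - cross_prod n1 n2" "cross_prod n2 n3 = cross_prod n1 n2"
    "cross_prod m1 m3 = - cross_prod m1 m2" "cross_prod m2 m3 = cross_prod m1 m2"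
    by (simp_all add: n3 m3 vec3_eq_iff algebra_simps)
  hence d1: "distinct [vec.span {n1}, vec.span {n2}, vec.span {n3}]"
    "distinct [vec.span {m1}, vec.span {m2}, vec.span {m3}]"
    using cn cm par by auto
  have d2: "vec.span {x} \<noteq> vec.span {y}" if "x \<in> {n1, n2, n3}" "y \<in> {m1, m2, m3}" for x y
  proof -
    have "vec.span {x} \<subseteq> L" "\<not> vec.span {y} \<subseteq> L" using that L mL span_sub[OF sub(1)] by auto
    thus ?thesis by auto
  qed
  have "L \<noteq> M" using L nM by blast
  \<comment> \<open>Each of the six points lies off one of the two lines.\<close>
  moreover have "L \<inter> M \<noteq> vec.span {x}" if "x \<in> {n1, n2, n3, m1, m2, m3}" for x
    using that nM mL span_sub[OF sub(1)] span_sub[OF sub(2)] by blast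
  hence "L \<inter> M \<notin> {vec.span {n1}, vec.span {n2}, vec.span {n3},
      vec.span {m1}, vec.span {m2}, vec.span {m3}}" by blast
  moreover have "distinct [vec.span {n1}, vec.span {n2}, vec.span {n3},
      vec.span {m1}, vec.span {m2}, vec.span {m3}]"
    using d1 d2[of n1] d2[of n2] d2[of n3] by simp
  moreover have "\<forall>q \<in> {vec.span {n1}, vec.span {n2}, vec.span {n3},
      vec.span {m1}, vec.span {m2}, vec.span {m3}}. proj_point q"
    using nz by (simp add: proj_point_span)
  moreover have "vec.span {n1} \<subseteq> L" "vec.span {n2} \<subseteq> L" "vec.span {n3} \<subseteq> L"
    "vec.span {m1} \<subseteq> M" "vec.span {m2} \<subseteq> M" "vec.span {m3} \<subseteq> M"
    using L M sub by (simp_all add: span_sub)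
  moreover have "proj_line L" "proj_line M"
    unfolding L_def M_def using cn cm by (simp_all add: proj_line_span)
  ultimately show ?thesis
    unfolding pappus_structure_def
    by - (rule exI[of _ "vec.span {n1}"], rule exI[of _ "vec.span {n2}"],
        rule exI[of _ "vec.span {n3}"], rule exI[of _ "vec.span {m1}"],
        rule exI[of _ "vec.span {m2}"], rule exI[of _ "vec.span {m3}"],
        rule exI[of _ L], rule exI[of _ M], intro conjI refl; assumption)
qed

text \<open>Affine coordinates on \<open>L\<close> with \<open>p\<close> at infinity. Division by 3
  allows the origin to be moved to the centroid, which makes the coordinates add up to 0.\<close>

lemma line_coordinates:
  fixes L :: "('a::field ^ 3) set"
  assumes L: "proj_line L" and q: "\<And>q. q \<in> {q1, q2, q3} \<Longrightarrow> proj_point q \<and> q \<subseteq> L \<and> q \<noteq> vec.span {p}"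
    and dist: "distinct [q1, q2, q3]" and p: "p \<noteq> 0" "p \<in> L" and three: "(3 :: 'a) \<noteq> 0"
  obtains u a1 a2 a3 where "cross_prod u p \<noteq> 0" "u \<in> L" "distinct [a1, a2, a3]"
    "a1 + a2 + a3 = 0" "q1 = vec.span {u + a1 *s p}" "q2 = vec.span {u + a2 *s p}"
    "q3 = vec.span {u + a3 *s p}"
proof -
  obtain x1 where x1: "x1 \<noteq> 0" "q1 = vec.span {x1}" using q[of q1] by (auto simp: proj_point_iff)
  have "cross_prod x1 p \<noteq> 0" using cross_prod_nonzero[of x1 p] x1 p q[of q1] by simp
  moreover have "x1 \<in> L" using q[of q1] x1(2) vec.span_base[of x1 "{x1}"] by auto
  ultimately have Leq: "L = vec.span {x1, p}" using proj_line_eq_span L p by blast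
  have ex: "\<exists>c. r = vec.span {x1 + c *s p}" if r: "r \<in> {q1, q2, q3}" for r
  proof -
    obtain x where x: "x \<noteq> 0" "r = vec.span {x}" using q[OF r] by (auto simp: proj_point_iff)
    have "x \<in> L" using q[OF r] x(2) vec.span_base[of x "{x}"] by auto
    then obtain c d where cd: "x = c *s x1 + d *s p" by (auto simp: Leq in_span_pair)
    \<comment> \<open>Otherwise the point would be the one at infinity, which is excluded.\<close>
    have "c \<noteq> 0"
    proof
      assume "c = 0"
      hence "x = d *s p" "d \<noteq> 0" using cd x by auto
      thus False using q[OF r] x(2) span_scale by blast
    qed
    hence "x = c *s (x1 + (d / c) *s p)" by (simp add: cd vec_eq_iff field_simps)
    thus ?thesis using x(2) span_scale[OF \<open>c \<noteq> 0\<close>] by metis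
  qed
  obtain c1 c2 c3 where c: "q1 = vec.span {x1 + c1 *s p}" "q2 = vec.span {x1 + c2 *s p}"
    "q3 = vec.span {x1 + c3 *s p}"
    using ex[of q1] ex[of q2] ex[of q3] by blast
  \<comment> \<open>The centroid; replacing \<open>x1\<close> by \<open>x1 + t *s p\<close> lowers
    every coordinate by \<open>t\<close>.\<close>
  define t where "t = (c1 + c2 + c3) / 3"
  have e: "x1 + t *s p + (c - t) *s p = x1 + c *s p" for c
    by (simp add: vec_eq_iff algebra_simps)
  have "cross_prod (x1 + t *s p) p = cross_prod x1 p"
    by (simp add: vec3_eq_iff algebra_simps)
  moreover have "x1 + t *s p \<in> L" unfolding Leq in_span_pair
    by (metis vector_smult_lid)
  moreover have "distinct [c1 - t, c2 - t, c3 - t]" using dist c by auto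
  moreover have "c1 - t + (c2 - t) + (c3 - t) = 0"
  proof -
    have "3 * t = c1 + c2 + c3" using three by (simp add: t_def)
    thus ?thesis by algebra
  qed
  ultimately show thesis
    using that[of "x1 + t *s p" "c1 - t" "c2 - t" "c3 - t"] c \<open>cross_prod x1 p \<noteq> 0\<close>
    by (simp add: e)
qed

text \<open>Expresses distinctness through the set alone, so that it survives relabelling.\<close>

lemma card_three_distinct: "card {x, y, z} = 3 \<longleftrightarrow> distinct [x, y, z]"
  by (auto simp: card_insert_if)

text \<open>The definition only provides some labelling. An equality of doubletons matches the
  triples up to a swap, and every conclusion depends only on the two sets, so it passes to the given
  labels.\<close>

lemma pappus_structure_labelledE:
  assumes "pappus_structure {{A1, A2, A3}, {B1, B2, B3}}"
  obtains L M where "proj_line L" "proj_line M" "L \<noteq> M" "distinct [A1, A2, A3]"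
    "distinct [B1, B2, B3]"
    "\<And>q. q \<in> {A1, A2, A3} \<Longrightarrow> proj_point q \<and> q \<subseteq> L \<and> q \<noteq> L \<inter> M"
    "\<And>q. q \<in> {B1, B2, B3} \<Longrightarrow> proj_point q \<and> q \<subseteq> M \<and> q \<noteq> L \<inter> M"
proof -
  obtain A1' A2' A3' B1' B2' B3' L M where
    S: "{{A1, A2, A3}, {B1, B2, B3}} = {{A1', A2', A3'}, {B1', B2', B3'}}"
    and pts: "\<forall>p \<in> {A1', A2', A3', B1', B2', B3'}. proj_point p"
    and d: "distinct [A1', A2', A3', B1', B2', B3']"
    and LM: "proj_line L" "A1' \<subseteq> L" "A2' \<subseteq> L" "A3' \<subseteq> L"
      "proj_line M" "B1' \<subseteq> M" "B2' \<subseteq> M" "B3' \<subseteq> M"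
      "L \<noteq> M" "L \<inter> M \<notin> {A1', A2', A3', B1', B2', B3'}"
    using assms unfolding pappus_structure_def by metis
  have card: "card {A1', A2', A3'} = 3" "card {B1', B2', B3'} = 3"
    using d by (simp_all only: card_three_distinct) auto
  have ne: "q \<noteq> L \<inter> M" if "q \<in> {A1', A2', A3', B1', B2', B3'}" for q
    using that LM(10) by metis
  have A': "proj_point q \<and> q \<subseteq> L \<and> q \<noteq> L \<inter> M" if "q \<in> {A1', A2', A3'}" for q
    using that pts LM ne[of q] by (elim insertE emptyE) simp_all
  have B': "proj_point q \<and> q \<subseteq> M \<and> q \<noteq> L \<inter> M" if "q \<in> {B1', B2', B3'}" for q
    using that pts LM ne[of q] by (elim insertE emptyE) simp_all
  from S consider "{A1, A2, A3} = {A1', A2', A3'}" "{B1, B2, B3} = {B1', B2', B3'}"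
    | "{A1, A2, A3} = {B1', B2', B3'}" "{B1, B2, B3} = {A1', A2', A3'}"
    by (auto simp only: doubleton_eq_iff)
  thus thesis
  proof cases
    case 1
    have "distinct [A1, A2, A3]" "distinct [B1, B2, B3]"
      using card[folded 1] by (simp_all only: card_three_distinct)
    from that[OF LM(1,5,9) this A'[folded 1] B'[folded 1]] show thesis .
  next
    case 2
    have "distinct [A1, A2, A3]" "distinct [B1, B2, B3]"
      using card[folded 2] by (simp_all only: card_three_distinct)
    from that[OF LM(5,1) LM(9)[symmetric] this B'[folded 2, unfolded Int_commute[of L]]
        A'[folded 2, unfolded Int_commute[of L]]]
    show thesis .
  qed
qed

section \<open>Cross-ratio and j-function\<close>

lemma det2_0 [simp]: "det2 0 y = 0" "det2 x 0 = 0"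
  by (simp_all add: det2_def)

lemma det2_scale: "det2 (c *s x) (d *s y) = c * d * det2 x y"
  by (simp add: det2_def algebra_simps)

lemma det2_affine:
  "det2 (c + a *s d) (c + b *s d) = (b - a) * det2 c d"
  "det2 (c + a *s d) d = det2 c d"
  by (simp_all add: det2_def algebra_simps)

text \<open>With \<open>d\<close> at infinity the two factors containing the fourth point cancel.
  Other representatives differ by nonzero scalars, each of which occurs once above and once below
  the fraction bar.\<close>

lemma cross_ratio_P1_affine:
  fixes c d :: "'a::field ^ 2"
  assumes cd: "det2 c d \<noteq> 0" and "a2 \<noteq> a3"
  shows "cross_ratio_P1 (vec.span {c + a1 *s d}) (vec.span {c + a2 *s d})
    (vec.span {c + a3 *s d}) (vec.span {d}) = (a1 - a3) / (a2 - a3)"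
  unfolding cross_ratio_P1_def
proof (rule the_equality)
  show "\<exists>u1 u2 u3 u4. vec.span {c + a1 *s d} = vec.span {u1} \<and> vec.span {c + a2 *s d} = vec.span {u2} \<and>
      vec.span {c + a3 *s d} = vec.span {u3} \<and> vec.span {d} = vec.span {u4} \<and>
      (a1 - a3) / (a2 - a3) = det2 u1 u3 * det2 u2 u4 / (det2 u2 u3 * det2 u1 u4)"
    using assms
    by (intro exI[of _ "c + a1 *s d"] exI[of _ "c + a2 *s d"] exI[of _ "c + a3 *s d"] exI[of _ d])
      (simp add: det2_affine field_simps)
next
  fix r
  assume "\<exists>u1 u2 u3 u4. vec.span {c + a1 *s d} = vec.span {u1} \<and> vec.span {c + a2 *s d} = vec.span {u2} \<and>
      vec.span {c + a3 *s d} = vec.span {u3} \<and> vec.span {d} = vec.span {u4} \<and>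
      r = det2 u1 u3 * det2 u2 u4 / (det2 u2 u3 * det2 u1 u4)"
  then obtain u1 u2 u3 u4 where u: "vec.span {u1} = vec.span {c + a1 *s d}"
    "vec.span {u2} = vec.span {c + a2 *s d}" "vec.span {u3} = vec.span {c + a3 *s d}"
    "vec.span {u4} = vec.span {d}"
    and r: "r = det2 u1 u3 * det2 u2 u4 / (det2 u2 u3 * det2 u1 u4)"
    by metis
  have "d \<noteq> 0" "c + a *s d \<noteq> 0" for a
    using cd det2_affine(2)[of c a d] by auto
  note nz = this
  obtain k1 where 1: "k1 \<noteq> 0" "u1 = k1 *s (c + a1 *s d)"
    using span_singleton_eqD[OF u(1) nz(2)] by blast
  obtain k2 where 2: "k2 \<noteq> 0" "u2 = k2 *s (c + a2 *s d)"
    using span_singleton_eqD[OF u(2) nz(2)] by blast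
  obtain k3 where 3: "k3 \<noteq> 0" "u3 = k3 *s (c + a3 *s d)"
    using span_singleton_eqD[OF u(3) nz(2)] by blast
  obtain k4 where 4: "k4 \<noteq> 0" "u4 = k4 *s d"
    using span_singleton_eqD[OF u(4) nz(1)] by blast
  show "r = (a1 - a3) / (a2 - a3)"
    using 1(1) 2(1) 3(1) 4(1) assms unfolding r 1(2) 2(2) 3(2) 4(2) det2_scale det2_affine by (simp add: field_simps)
qed

text \<open>The map sending the standard basis to \<open>u\<close> and \<open>p\<close> shows that
  the value is attained. For uniqueness, any other parametrization pulls the four points back to the
  same affine form in k^2.\<close>

lemma cross_ratio_affine:
  fixes u p :: "'a::field ^ 3"
  assumes up: "cross_prod u p \<noteq> 0" and "a2 \<noteq> a3"
  shows "cross_ratio (vec.span {u + a1 *s p}) (vec.span {u + a2 *s p})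
    (vec.span {u + a3 *s p}) (vec.span {p}) = (a1 - a3) / (a2 - a3)"
  unfolding cross_ratio_def
proof (rule the_equality)
  define f :: "'a ^ 2 \<Rightarrow> 'a ^ 3" where "f = (\<lambda>w. w$1 *s u + w$2 *s p)"
  have lin: "Vector_Spaces.linear (*s) (*s) f"
    by unfold_locales (simp_all add: f_def vec_eq_iff algebra_simps)
  have ker: "w = 0" if "f w = 0" for w
  proof -
    have "cross_prod (f w) p = w$1 *s cross_prod u p" "cross_prod u (f w) = w$2 *s cross_prod u p"
      by (simp_all add: f_def vec3_eq_iff algebra_simps)
    moreover have "cross_prod 0 p = 0" "cross_prod u 0 = 0" by (simp_all add: vec3_eq_iff)
    ultimately have "w$1 = 0 \<and> w$2 = 0" using that up by simp
    thus ?thesis by (simp add: vec_eq_iff forall_2)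
  qed
  hence inj: "inj f" using vec.linear_inj_iff_eq_0[OF lin] by blast
  define c d :: "'a ^ 2" where "c = vector [1, 0]" and "d = vector [0, 1]"
  have cd: "det2 c d \<noteq> 0" "f c = u" "f d = p" by (simp_all add: c_def d_def det2_def f_def)
  have f: "f (c + a *s d) = u + a *s p" for a
    using cd by (simp add: vec.linear_add[OF lin] vec.linear_scale[OF lin])
  have "d \<noteq> 0" "c + a *s d \<noteq> 0" for a
    using cd det2_affine(2)[of c a d] by auto
  hence "proj_point (vec.span {d})" "proj_point (vec.span {c + a *s d})" for a
    by (simp_all add: proj_point_span)
  moreover have "f ` vec.span {w} = vec.span {f w}" for w
    using vec.linear_span_image[OF lin, of "{w}"] by simp
  ultimately show "\<exists>f X1 X2 X3 X4. Vector_Spaces.linear (*s) (*s) f \<and> inj f \<and>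
      proj_point X1 \<and> proj_point X2 \<and> proj_point X3 \<and> proj_point X4 \<and>
      vec.span {u + a1 *s p} = f ` X1 \<and> vec.span {u + a2 *s p} = f ` X2 \<and>
      vec.span {u + a3 *s p} = f ` X3 \<and> vec.span {p} = f ` X4 \<and>
      (a1 - a3) / (a2 - a3) = cross_ratio_P1 X1 X2 X3 X4"
    using lin inj cross_ratio_P1_affine[OF cd(1) assms(2), of a1] f cd(3)
    by (intro exI[of _ f] exI[of _ "vec.span {c + a1 *s d}"] exI[of _ "vec.span {c + a2 *s d}"]
        exI[of _ "vec.span {c + a3 *s d}"] exI[of _ "vec.span {d}"]) simp
next
  fix r
  assume "\<exists>f X1 X2 X3 X4. Vector_Spaces.linear (*s) (*s) f \<and> inj f \<and>
      proj_point X1 \<and> proj_point X2 \<and> proj_point X3 \<and> proj_point X4 \<and>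
      vec.span {u + a1 *s p} = f ` X1 \<and> vec.span {u + a2 *s p} = f ` X2 \<and>
      vec.span {u + a3 *s p} = f ` X3 \<and> vec.span {p} = f ` X4 \<and>
      r = cross_ratio_P1 X1 X2 X3 X4"
  then obtain f :: "'a ^ 2 \<Rightarrow> 'a ^ 3" and X1 X2 X3 X4 where
    lin: "Vector_Spaces.linear (*s) (*s) f" and inj: "inj f"
    and X: "vec.span {u + a1 *s p} = f ` X1" "vec.span {u + a2 *s p} = f ` X2"
      "vec.span {u + a3 *s p} = f ` X3" "vec.span {p} = f ` X4"
    and r: "r = cross_ratio_P1 X1 X2 X3 X4"
    by blast
  obtain e where e: "f e = u + a1 *s p"
    using X(1) vec.span_base[of "u + a1 *s p" "{u + a1 *s p}"] by force
  obtain d where d: "f d = p" using X(4) vec.span_base[of p "{p}"] by force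
  \<comment> \<open>Chosen so that \<open>f\<close> maps \<open>c\<close> to
    \<open>u\<close>.\<close>
  define c where "c = e - a1 *s d"
  have c: "f c = u"
    by (simp add: c_def vec.linear_diff[OF lin] vec.linear_scale[OF lin] e d)
  have f: "f (c + a *s d) = u + a *s p" for a
    by (simp add: c d vec.linear_add[OF lin] vec.linear_scale[OF lin])
  have img: "X = vec.span {w}" if "vec.span {f w} = f ` X" for X w
  proof -
    have "f ` vec.span {w} = vec.span {f w}"
      using vec.linear_span_image[OF lin, of "{w}"] by simp
    thus ?thesis using that inj by (simp add: inj_image_eq_iff)
  qed
  have "det2 c d \<noteq> 0"
  proof
    assume z: "det2 c d = 0"
    \<comment> \<open>A vanishing determinant makes both arguments of \<open>f\<close> zero;
      independence of \<open>u\<close> and \<open>p\<close> then forces \<open>d = 0\<close>,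
      contradicting \<open>p \<noteq> 0\<close>.\<close>
    have "f (c$1 *s d - d$1 *s c) = c$1 *s p - d$1 *s u" "f (c$2 *s d - d$2 *s c) = c$2 *s p - d$2 *s u"
      by (simp_all add: c d vec.linear_diff[OF lin] vec.linear_scale[OF lin])
    moreover have "c$1 *s d - d$1 *s c = 0" "c$2 *s d - d$2 *s c = 0"
      using z by (simp_all add: det2_def vec_eq_iff forall_2 algebra_simps)
    ultimately have "c$1 *s p - d$1 *s u = 0" "c$2 *s p - d$2 *s u = 0"
      by (simp_all add: vec.linear_0[OF lin])
    moreover have "cross_prod u (c$i *s p - d$i *s u) = c$i *s cross_prod u p"
      "cross_prod (c$i *s p - d$i *s u) p = - d$i *s cross_prod u p" for i
      by (simp_all add: vec3_eq_iff algebra_simps)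
    moreover have "cross_prod 0 p = 0" "cross_prod u 0 = 0" by (simp_all add: vec3_eq_iff)
    ultimately have "d$1 = 0 \<and> d$2 = 0" using up 
      by (metis neg_equal_0_iff_equal vector_mul_eq_0)
    hence "d = 0" by (simp add: vec_eq_iff forall_2)
    hence "p = 0" using d vec.linear_0[OF lin] by simp
    thus False using up by (auto simp: vec3_eq_iff)
  qed
  thus "r = (a1 - a3) / (a2 - a3)"
    using cross_ratio_P1_affine[OF _ assms(2), of c d a1] X f d
      img[of "c + a1 *s d" X1] img[of "c + a2 *s d" X2] img[of "c + a3 *s d" X3] img[of d X4]
    by (simp add: r)
qed

text \<open>The discriminant formula in disguise: \<open>a1\<close>, \<open>a2\<close>,
  \<open>a3\<close> are the roots of a cubic t^3 + P t - e with e = a1 a2 a3, and j(r) is -4 P^3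
  divided by the discriminant -4 P^3 - 27 e^2.\<close>

lemma j_fun_affine:
  fixes a1 a2 a3 :: "'a::field"
  assumes dist: "distinct [a1, a2, a3]" and sum: "a1 + a2 + a3 = 0" and three: "(3 :: 'a) \<noteq> 0"
  shows "j_fun ((a1 - a3) / (a2 - a3)) =
    1 + 27 * (a1 * a2 * a3)\<^sup>2 / ((a1 - a2) * (a2 - a3) * (a3 - a1))\<^sup>2"
proof -
  define e where "e = a2 - a3"
  define d where "d = (a1 - a2) * (a2 - a3) * (a3 - a1)"
  define q where "q = a1\<^sup>2 + a2\<^sup>2 + a3\<^sup>2 - a1 * a2 - a1 * a3 - a2 * a3"
  have nz: "e \<noteq> 0" "d \<noteq> 0" using dist by (auto simp: e_def d_def)
  have "(27 :: 'a) = 3 ^ 3" by simp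
  hence 27: "(27 :: 'a) \<noteq> 0" using three by (metis power_not_zero)
  let ?r = "(a1 - a3) / e"
  have r1: "?r - 1 = (a1 - a2) / e" using nz(1) by (simp add: field_simps e_def)
  have r2: "?r\<^sup>2 - ?r + 1 = q / e\<^sup>2"
    using nz(1) by (simp add: field_simps power2_eq_square q_def) (simp add: e_def algebra_simps)
  have d: "d = (a1 - a2) * e * (a3 - a1)" by (simp add: d_def e_def)
  have "27 * ?r\<^sup>2 * (?r - 1)\<^sup>2 = 27 * d\<^sup>2 / e ^ 6"
    unfolding r1 using nz(1) by (simp add: field_simps) (intro disjI2, unfold d, algebra)
  hence "j_fun ?r = 4 * q ^ 3 / (27 * d\<^sup>2)"
    unfolding j_fun_def r2 using nz 27 by (simp add: field_simps)
  \<comment> \<open>As the roots add up to 0, \<open>q\<close> is -3 times their second elementary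
    symmetric function, and \<open>d\<^sup>2\<close> is the discriminant.\<close>
  moreover have "4 * q ^ 3 = 27 * d\<^sup>2 + 27 * 27 * (a1 * a2 * a3)\<^sup>2"
  proof -
    have eq: "a3 = - a1 - a2" using sum by (simp add: eq_neg_iff_add_eq_0 algebra_simps)
    show ?thesis unfolding q_def d_def eq by algebra
  qed
  moreover have frac: "(k * x + k * k * m) / (k * x) = 1 + k * m / x"
    if "k \<noteq> 0" "x \<noteq> 0" for k x m :: 'a
    using that by (simp add: field_simps)
  ultimately have "j_fun ?r = 1 + 27 * (a1 * a2 * a3)\<^sup>2 / d\<^sup>2"
    using frac[of 27 "d\<^sup>2" "(a1 * a2 * a3)\<^sup>2"] nz 27 by simp
  thus ?thesis by (simp add: e_def d_def)
qed

lemma inner_products_nonzero: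
  fixes a1 a2 a3 b1 b2 b3 :: "'a::field"
  assumes dist: "distinct [a1, a2, a3]" "distinct [b1, b2, b3]"
    and sum: "a1 + a2 + a3 = 0" "b1 + b2 + b3 = 0" and three: "(3 :: 'a) \<noteq> 0"
    and j: "j = j_fun ((a1 - a3) / (a2 - a3))" "j' = j_fun ((b1 - b3) / (b2 - b3))"
      "j + j' \<noteq> j * j'"
  shows "a1 * b1 + a2 * b2 + a3 * b3 \<noteq> 0" "a1 * b2 + a2 * b3 + a3 * b1 \<noteq> 0"
    "a1 * b3 + a2 * b1 + a3 * b2 \<noteq> 0" "a1 * b2 + a2 * b1 + a3 * b3 \<noteq> 0"
    "a1 * b3 + a2 * b2 + a3 * b1 \<noteq> 0" "a1 * b1 + a2 * b3 + a3 * b2 \<noteq> 0"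
proof -
  define d where "d = (a1 - a2) * (a2 - a3) * (a3 - a1)"
  define d' where "d' = (b1 - b2) * (b2 - b3) * (b3 - b1)"
  let ?e = "27 * (a1 * a2 * a3) * (b1 * b2 * b3)"
  have nz: "d \<noteq> 0" "d' \<noteq> 0" using dist by (auto simp: d_def d'_def)
  have j_eq: "j = 1 + 27 * (a1 * a2 * a3)\<^sup>2 / d\<^sup>2" "j' = 1 + 27 * (b1 * b2 * b3)\<^sup>2 / d'\<^sup>2"
    using j_fun_affine[OF dist(1) sum(1) three] j_fun_affine[OF dist(2) sum(2) three] j
    by (simp_all add: d_def d'_def)
  \<comment> \<open>Centring both values at 1 turns the hypothesis into an inequality of two
    squares, which is then factored.\<close>
  have "j + j' - j * j' = 1 - (j - 1) * (j' - 1)" by algebra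
  also have "\<dots> = 1 - (?e)\<^sup>2 / (d * d')\<^sup>2"
    unfolding j_eq by (simp add: power_mult_distrib)
  finally have ne: "(?e)\<^sup>2 \<noteq> (d * d')\<^sup>2" using j(3) nz by auto
  have eqs: "a3 = - a1 - a2" "b3 = - b1 - b2"
    using sum by (simp_all add: eq_neg_iff_add_eq_0 algebra_simps)
  have "2 * ((a1 * b1 + a2 * b2 + a3 * b3) * (a1 * b2 + a2 * b3 + a3 * b1) *
      (a1 * b3 + a2 * b1 + a3 * b2)) = ?e + d * d'"
    unfolding d_def d'_def eqs by algebra
  \<comment> \<open>The previous identity with \<open>b1\<close> and \<open>b2\<close> exchanged:
    this changes the sign of \<open>d'\<close> and keeps the product of the b_i.\<close>
  moreover have "2 * ((a1 * b2 + a2 * b1 + a3 * b3) * (a1 * b3 + a2 * b2 + a3 * b1) *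
      (a1 * b1 + a2 * b3 + a3 * b2)) = ?e - d * d'"
    unfolding d_def d'_def eqs by algebra
  moreover have "?e + d * d' \<noteq> 0" "?e - d * d' \<noteq> 0"
    using ne by (auto simp: eq_neg_iff_add_eq_0[symmetric])
  ultimately show "a1 * b1 + a2 * b2 + a3 * b3 \<noteq> 0" "a1 * b2 + a2 * b3 + a3 * b1 \<noteq> 0"
    "a1 * b3 + a2 * b1 + a3 * b2 \<noteq> 0" "a1 * b2 + a2 * b1 + a3 * b3 \<noteq> 0"
    "a1 * b3 + a2 * b2 + a3 * b1 \<noteq> 0" "a1 * b1 + a2 * b3 + a3 * b2 \<noteq> 0"
    by (metis mult_zero_left mult_zero_right)+
qed

section \<open>Pappus and Leisenring lines in coordinates\<close>

text \<open>First coordinate of the covector of a Pappus line in the frame below, obtained from two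
  of its three points. Exchanging the rows gives minus the second coordinate;
  \<open>steiner_z\<close> is the third.\<close>

definition steiner_x :: "'a::field \<Rightarrow> 'a \<Rightarrow> 'a \<Rightarrow> 'a \<Rightarrow> 'a \<Rightarrow> 'a \<Rightarrow> 'a" where
  "steiner_x a1 a2 a3 b1 b2 b3 =
    (a1 - a2) * (a2 * b2 - a3 * b3) - (a1 * b1 - a2 * b2) * (a2 - a3)"

definition steiner_z :: "'a::field \<Rightarrow> 'a \<Rightarrow> 'a \<Rightarrow> 'a \<Rightarrow> 'a \<Rightarrow> 'a \<Rightarrow> 'a" where
  "steiner_z a1 a2 a3 b1 b2 b3 = (b1 - b2) * (a2 - a3) - (a1 - a2) * (b2 - b3)"

text \<open>The combination used is, up to the determinant of the frame, the value of the Pappus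
  covector at A_2; so A_2 is not on the line.\<close>

lemma steiner_xz_nonzero:
  fixes a1 a2 a3 b1 b2 b3 :: "'a::field"
  assumes "distinct [a1, a2, a3]" "distinct [b1, b2, b3]"
  shows "steiner_x a1 a2 a3 b1 b2 b3 \<noteq> 0 \<or> steiner_z a1 a2 a3 b1 b2 b3 \<noteq> 0"
proof -
  have "steiner_x a1 a2 a3 b1 b2 b3 + a2 * steiner_z a1 a2 a3 b1 b2 b3
      = (b3 - b1) * (a1 - a2) * (a2 - a3)"
    by (simp add: steiner_x_def steiner_z_def algebra_simps)
  moreover have "(b3 - b1) * (a1 - a2) * (a2 - a3) \<noteq> 0" using assms by auto
  ultimately show ?thesis by force
qed

section \<open>Homogeneous coordinates relative to a frame\<close>

locale frame =
  fixes u v p :: "'a::field ^ 3"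
  assumes indep: "scalar_product (cross_prod u v) p \<noteq> 0"
begin

definition pt :: "'a \<Rightarrow> 'a \<Rightarrow> 'a \<Rightarrow> 'a ^ 3" where
  "pt x y z = x *s u + y *s v + z *s p"

text \<open>The three cross products are \<open>D\<close> times the basis dual to \<open>u\<close>,
  \<open>v\<close>, \<open>p\<close>, so covectors get coordinates without division.\<close>

definition fn :: "'a \<Rightarrow> 'a \<Rightarrow> 'a \<Rightarrow> 'a ^ 3" where
  "fn x y z = x *s cross_prod v p + y *s cross_prod p u + z *s cross_prod u v"

abbreviation "D \<equiv> scalar_product (cross_prod u v) p"

lemma fn_cong: "x = x' \<Longrightarrow> y = y' \<Longrightarrow> z = z' \<Longrightarrow> fn x y z = fn x' y' z'"
  by simp

lemma cross_pt: "cross_prod (pt x y z) (pt x' y' z') =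
    fn (y * z' - z * y') (z * x' - x * z') (x * y' - y * x')"
  by (simp add: pt_def fn_def vec3_eq_iff algebra_simps)

lemma cross_fn: "cross_prod (fn x y z) (fn x' y' z') =
    D *s pt (y * z' - z * y') (z * x' - x * z') (x * y' - y * x')"
  unfolding pt_def fn_def vec3_eq_iff
  by (simp add: scalar_product_3) algebra

lemma fn_pt: "scalar_product (fn x y z) (pt x' y' z') = D * (x * x' + y * y' + z * z')"
  unfolding pt_def fn_def by (simp add: scalar_product_3) algebra

lemma pt_fn: "scalar_product (pt x y z) (fn x' y' z') = D * (x * x' + y * y' + z * z')"
  unfolding pt_def fn_def by (simp add: scalar_product_3) algebra

lemma pt_eq_0: "pt x y z = 0 \<longleftrightarrow> x = 0 \<and> y = 0 \<and> z = 0"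
proof
  assume "pt x y z = 0"
  hence "D * (c1 * x + c2 * y + c3 * z) = 0" for c1 c2 c3
    using fn_pt[of c1 c2 c3 x y z] by simp
  from this[of 1 0 0] this[of 0 1 0] this[of 0 0 1] show "x = 0 \<and> y = 0 \<and> z = 0"
    using indep by simp
qed (simp add: pt_def)

lemma fn_eq_0: "fn x y z = 0 \<longleftrightarrow> x = 0 \<and> y = 0 \<and> z = 0"
proof
  assume "fn x y z = 0"
  hence "D * (x * c1 + y * c2 + z * c3) = 0" for c1 c2 c3
    using fn_pt[of x y z c1 c2 c3] by simp
  from this[of 1 0 0] this[of 0 1 0] this[of 0 0 1] show "x = 0 \<and> y = 0 \<and> z = 0"
    using indep by simp
qed (simp add: fn_def)

section \<open>Joins, meets and the center in frame coordinates\<close>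

lemma join_pt:
  assumes "y * z' - z * y' \<noteq> 0 \<or> z * x' - x * z' \<noteq> 0 \<or> x * y' - y * x' \<noteq> 0"
  shows "join (vec.span {pt x y z}) (vec.span {pt x' y' z'}) =
    orth (fn (y * z' - z * y') (z * x' - x * z') (x * y' - y * x'))"
  using assms by (simp add: join_span span_pair_eq_orth cross_pt fn_eq_0)

lemma meet_fn:
  assumes "y * z' - z * y' \<noteq> 0 \<or> z * x' - x * z' \<noteq> 0 \<or> x * y' - y * x' \<noteq> 0"
  shows "orth (fn x y z) \<inter> orth (fn x' y' z') =
    vec.span {pt (y * z' - z * y') (z * x' - x * z') (x * y' - y * x')}"
  using assms indep
  by (subst orth_Int_orth) (simp_all add: cross_fn span_scale pt_eq_0)

lemma join_A_B: "join (vec.span {pt 1 0 a}) (vec.span {pt 0 1 b}) = orth (fn (- a) (- b) 1)"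
  by (subst join_pt) simp_all

text \<open>Gives both the points that determine a Pappus line and the points Q_i of Leisenring's
  construction.\<close>

lemma cross_joins:
  assumes "a \<noteq> a'"
  shows "join (vec.span {pt 1 0 a}) (vec.span {pt 0 1 b'}) \<inter>
      join (vec.span {pt 1 0 a'}) (vec.span {pt 0 1 b}) =
    vec.span {pt (b - b') (a - a') (a * b - a' * b')}"
proof -
  have "orth (fn (- a) (- b') 1) \<inter> orth (fn (- a') (- b) 1) =
    vec.span {pt (b - b') (a - a') (a * b - a' * b')}"
    using assms by (subst meet_fn) (simp_all add: algebra_simps)
  thus ?thesis by (simp add: join_A_B)
qed

lemma center_eq:
  assumes "A 1 = vec.span {pt 1 0 a1}" "A 2 = vec.span {pt 1 0 a2}"
    "B 1 = vec.span {pt 0 1 b1}" "B 2 = vec.span {pt 0 1 b2}" "a1 \<noteq> a2" "b1 \<noteq> b2"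
  shows "center A B = vec.span {pt 0 0 1}"
proof -
  have "center A B = orth (fn 0 (a1 - a2) 0) \<inter> orth (fn (b2 - b1) 0 0)"
    unfolding center_def assms(1-4) using assms(5,6) by (simp add: join_pt)
  also have "\<dots> = vec.span {pt 0 0 (- ((a1 - a2) * (b2 - b1)))}"
    using assms(5,6) by (subst meet_fn) simp_all
  also have "pt 0 0 (- ((a1 - a2) * (b2 - b1))) = (- ((a1 - a2) * (b2 - b1))) *s pt 0 0 1"
    by (simp add: pt_def)
  also have "vec.span {\<dots>} = vec.span {pt 0 0 1}"
    using assms(5,6) by (intro span_scale) simp
  finally show ?thesis .
qed

section \<open>Covectors of the Pappus and Leisenring lines\<close>

lemma dual_pappus_line:
  assumes A: "A 1 = vec.span {pt 1 0 a1}" "A 2 = vec.span {pt 1 0 a2}" "A 3 = vec.span {pt 1 0 a3}"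
    and B: "B (\<sigma> 1) = vec.span {pt 0 1 b1}" "B (\<sigma> 2) = vec.span {pt 0 1 b2}"
      "B (\<sigma> 3) = vec.span {pt 0 1 b3}"
    and dist: "distinct [a1, a2, a3]" "distinct [b1, b2, b3]"
  shows "dual_point (pappus_line A B \<sigma>) = vec.span {fn (steiner_x a1 a2 a3 b1 b2 b3)
    (- steiner_x b1 b2 b3 a1 a2 a3) (steiner_z a1 a2 a3 b1 b2 b3)}" (is "_ = vec.span {?n}")
proof -
  let ?q = "\<lambda>a a' b b'. pt (b - b') (a - a') (a * b - a' * b')"
  have n: "cross_prod (?q a1 a2 b1 b2) (?q a2 a3 b2 b3) = ?n"
    by (simp add: cross_pt steiner_x_def steiner_z_def algebra_simps)
  have nz: "?n \<noteq> 0" using steiner_xz_nonzero[OF dist] by (auto simp: fn_eq_0)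
  \<comment> \<open>Pappus's theorem: this vector is the sum of the other two.\<close>
  have "?q a1 a3 b1 b3 \<in> orth (cross_prod (?q a1 a2 b1 b2) (?q a2 a3 b2 b3))"
    unfolding cross_pt orth_def by (simp add: fn_pt) algebra
  hence "pappus_line A B \<sigma> = orth ?n"
    unfolding pappus_line_def
    using dist the_proj_line[of "?q a1 a2 b1 b2" "?q a2 a3 b2 b3" "?q a1 a3 b1 b3"] nz
    by (simp add: A B cross_joins n del: One_nat_def)
  thus ?thesis using dual_point_orth[OF nz] by simp
qed

lemma dual_leisenring_line:
  assumes A: "A 1 = vec.span {pt 1 0 a1}" "A 2 = vec.span {pt 1 0 a2}" "A 3 = vec.span {pt 1 0 a3}"
    and B: "B 1 = vec.span {pt 0 1 b1}" "B 2 = vec.span {pt 0 1 b2}" "B 3 = vec.span {pt 0 1 b3}"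
    and dist: "distinct [a1, a2, a3]" "distinct [b1, b2, b3]"
    and sum: "a1 + a2 + a3 = 0" "b1 + b2 + b3 = 0" and "(2 :: 'a) \<noteq> 0"
  shows "dual_point (leisenring_line A B) = vec.span {fn (- 2 * steiner_x a1 a2 a3 b1 b2 b3)
    (2 * steiner_x b1 b2 b3 a1 a2 a3) (steiner_z a1 a2 a3 b1 b2 b3)}" (is "_ = vec.span {?n}")
proof -
  \<comment> \<open>Coordinates of R_i, the meet of P Q_i with A_i B_i.\<close>
  define r where "r = (\<lambda>ai aj al bi bj bl :: 'a.
    pt (bj - bl) (aj - al) (ai * (bj - bl) + bi * (aj - al)))"
  have R: "join (vec.span {pt 0 0 1}) (vec.span {pt (bj - bl) (aj - al) (aj * bj - al * bl)}) \<inter>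
      join (vec.span {pt 1 0 ai}) (vec.span {pt 0 1 bi}) = vec.span {r ai aj al bi bj bl}"
    if "aj \<noteq> al" for ai aj al bi bj bl
  proof -
    have "join (vec.span {pt 0 0 1}) (vec.span {pt (bj - bl) (aj - al) (aj * bj - al * bl)}) =
      orth (fn (al - aj) (bj - bl) 0)"
      using that by (subst join_pt) simp_all
    moreover have "orth (fn (al - aj) (bj - bl) 0) \<inter> orth (fn (- ai) (- bi) 1) =
      vec.span {r ai aj al bi bj bl}"
      using that by (subst meet_fn) (simp_all add: r_def algebra_simps)
    ultimately show ?thesis by (simp add: join_A_B)
  qed
  have C: "center A B = vec.span {pt 0 0 1}"
    using dist by (intro center_eq[of A a1 a2 B b1 b2] A B) auto
  have eqs: "a3 = - a1 - a2" "b3 = - b1 - b2"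
    using sum by (simp_all add: eq_neg_iff_add_eq_0 algebra_simps)
  \<comment> \<open>The centroid normalization enters here: after eliminating \<open>a3\<close> and
    \<open>b3\<close> the coordinates become those of the Pappus line with the first two multiplied
    by -2.\<close>
  have n: "cross_prod (r a1 a2 a3 b1 b2 b3) (r a2 a3 a1 b2 b3 b1) = ?n"
    unfolding r_def cross_pt steiner_x_def steiner_z_def eqs by (rule fn_cong; algebra)
  have nz: "?n \<noteq> 0" using steiner_xz_nonzero[OF dist] \<open>2 \<noteq> 0\<close> by (auto simp: fn_eq_0)
  \<comment> \<open>Leisenring's theorem: the three vectors \<open>r\<close> add up to 0.\<close>
  have "r a3 a1 a2 b3 b1 b2 \<in> orth (cross_prod (r a1 a2 a3 b1 b2 b3) (r a2 a3 a1 b2 b3 b1))"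
    unfolding cross_pt r_def orth_def by (simp add: fn_pt) algebra
  moreover have ne: "a3 \<noteq> a1" "a2 \<noteq> a3" using dist by auto
  ultimately have "leisenring_line A B = orth ?n"
    unfolding leisenring_line_def Let_def
    using dist ne nz the_proj_line[of "r a1 a2 a3 b1 b2 b3" "r a2 a3 a1 b2 b3 b1" "r a3 a1 a2 b3 b1 b2"]
    by (simp add: C A B cross_joins R n del: One_nat_def)
  thus ?thesis using dual_point_orth[OF nz] by simp
qed

text \<open>The scalar k is 1 for Pappus lines and - 2 for Leisenring lines.\<close>
definition line_vec :: "'a \<Rightarrow> 'a \<Rightarrow> 'a \<Rightarrow> 'a \<Rightarrow> 'a \<Rightarrow> 'a \<Rightarrow> 'a \<Rightarrow> 'a ^ 3" where
  "line_vec k a1 a2 a3 b1 b2 b3 = fn (k * steiner_x a1 a2 a3 b1 b2 b3)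
    (- k * steiner_x b1 b2 b3 a1 a2 a3) (steiner_z a1 a2 a3 b1 b2 b3)"

section \<open>The two dual structures and the map between them\<close>

lemma fn_add: "fn x y z + fn x' y' z' = fn (x + x') (y + y') (z + z')"
  by (simp add: fn_def vec_eq_iff algebra_simps)

text \<open>The linear relation behind the concurrency of the lines of one parity: the Pappus lines
  for \<open>k = 1\<close>, Rigby's theorem for \<open>k = - 2\<close>. Cyclic shifts of the b_i
  preserve parity.\<close>

lemma line_vec_sum:
  assumes "a1 + a2 + a3 = 0" "b1 + b2 + b3 = 0"
  shows "line_vec k a1 a2 a3 b1 b2 b3 + line_vec k a1 a2 a3 b2 b3 b1 + line_vec k a1 a2 a3 b3 b1 b2 = 0"
proof -
  have eqs: "a3 = - a1 - a2" "b3 = - b1 - b2"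
    using assms by (simp_all add: eq_neg_iff_add_eq_0 algebra_simps)
  show ?thesis
    unfolding line_vec_def fn_add fn_eq_0 steiner_x_def steiner_z_def eqs by (intro conjI; algebra)
qed

text \<open>Tests whether a line passes through the meet of two lines of the opposite parity. Once
  \<open>k\<close> and 3 are nonzero and the coordinates distinct, only the last factor decides;
  permuting the b_i yields all six cases.\<close>

lemma line_vec_det:
  assumes "a1 + a2 + a3 = 0" "b1 + b2 + b3 = 0"
  shows "scalar_product (cross_prod (line_vec k a1 a2 a3 b2 b1 b3) (line_vec k a1 a2 a3 b3 b2 b1))
      (line_vec k a1 a2 a3 b1 b2 b3) =
    - 3 * (k * D)\<^sup>2 * ((a1 - a2) * (a2 - a3) * (a3 - a1)) * ((b1 - b2) * (b2 - b3) * (b3 - b1)) *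
      (a1 * b1 + a2 * b2 + a3 * b3)"
proof -
  have eqs: "a3 = - a1 - a2" "b3 = - b1 - b2"
    using assms by (simp_all add: eq_neg_iff_add_eq_0 algebra_simps)
  \<comment> \<open>A triple product of covectors is \<open>D\<^sup>2\<close> times the determinant
    of their frame coordinates.\<close>
  have *: "scalar_product (cross_prod (fn x y z) (fn x' y' z')) (fn x'' y'' z'') =
      D\<^sup>2 * ((y * z' - z * y') * x'' + (z * x' - x * z') * y'' + (x * y' - y * x') * z'')"
    for x y z x' y' z' x'' y'' z''
  proof -
    have "scalar_product (c *s w) w' = c * scalar_product w w'" for c and w w' :: "'a ^ 3"
      by (simp add: scalar_product_3 algebra_simps)
    thus ?thesis unfolding cross_fn by (simp add: pt_fn power2_eq_square)
  qed
  show ?thesis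
    unfolding line_vec_def * steiner_x_def steiner_z_def eqs by algebra
qed

lemma pappus_structure_line_vec:
  assumes dist: "distinct [a1, a2, a3]" "distinct [b1, b2, b3]"
    and sum: "a1 + a2 + a3 = 0" "b1 + b2 + b3 = 0" and three: "(3 :: 'a) \<noteq> 0" and k: "k \<noteq> 0"
    and S: "a1 * b1 + a2 * b2 + a3 * b3 \<noteq> 0" "a1 * b2 + a2 * b3 + a3 * b1 \<noteq> 0"
      "a1 * b3 + a2 * b1 + a3 * b2 \<noteq> 0" "a1 * b2 + a2 * b1 + a3 * b3 \<noteq> 0"
      "a1 * b3 + a2 * b2 + a3 * b1 \<noteq> 0" "a1 * b1 + a2 * b3 + a3 * b2 \<noteq> 0"
  shows "pappus_structure
    {{vec.span {line_vec k a1 a2 a3 b1 b2 b3}, vec.span {line_vec k a1 a2 a3 b2 b3 b1},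
      vec.span {line_vec k a1 a2 a3 b3 b1 b2}},
     {vec.span {line_vec k a1 a2 a3 b2 b1 b3}, vec.span {line_vec k a1 a2 a3 b3 b2 b1},
      vec.span {line_vec k a1 a2 a3 b1 b3 b2}}}"
proof -
  let ?w = "line_vec k a1 a2 a3"
  have det: "scalar_product (cross_prod (?w c2 c1 c3) (?w c3 c2 c1)) (?w c1 c2 c3) \<noteq> 0"
    if "c1 + c2 + c3 = 0" "distinct [c1, c2, c3]" "a1 * c1 + a2 * c2 + a3 * c3 \<noteq> 0" for c1 c2 c3
    unfolding line_vec_det[OF sum(1) that(1)] using three k indep dist(1) that(2,3) by auto
  \<comment> \<open>The pair of opposite lines in \<open>det\<close> varies with the labelling,
    whereas \<open>pappus_structureI\<close> fixes one pair; zero sum makes all cyclically ordered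
    pairs equivalent.\<close>
  have cyc: "cross_prod y z = cross_prod x y" "cross_prod z x = cross_prod x y"
    if "x + y + z = 0" for x y z :: "'a ^ 3"
  proof -
    have z: "z = - x - y" using that by (simp add: eq_neg_iff_add_eq_0 algebra_simps)
    show "cross_prod y z = cross_prod x y" "cross_prod z x = cross_prod x y"
      unfolding z by (simp_all add: vec3_eq_iff algebra_simps)
  qed
  \<comment> \<open>For an odd labelling the pair appears in reverse order, which only changes the
    sign.\<close>
  have anti: "scalar_product (cross_prod x y) z = 0 \<longleftrightarrow> scalar_product (cross_prod y x) z = 0"
    for x y z :: "'a ^ 3"
    by (simp add: scalar_product_3) algebra
  have n: "?w b1 b2 b3 + ?w b2 b3 b1 + ?w b3 b1 b2 = 0" by (rule line_vec_sum[OF sum])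
  have m: "?w b2 b1 b3 + ?w b3 b2 b1 + ?w b1 b3 b2 = 0"
    using line_vec_sum[OF sum(1), of b2 b1 b3 k] sum(2) by (simp add: ac_simps)
  have "scalar_product (cross_prod (?w b2 b1 b3) (?w b3 b2 b1)) x \<noteq> 0"
    if "x \<in> {?w b1 b2 b3, ?w b2 b3 b1, ?w b3 b1 b2}" for x
    using that det[of b1 b2 b3] det[of b2 b3 b1] det[of b3 b1 b2] dist(2) sum(2) S cyc[OF m]
    by (auto simp: ac_simps)
  moreover have "scalar_product (cross_prod (?w b1 b2 b3) (?w b2 b3 b1)) x \<noteq> 0"
    if "x \<in> {?w b2 b1 b3, ?w b3 b2 b1, ?w b1 b3 b2}" for x
    using that det[of b2 b1 b3] det[of b3 b2 b1] det[of b1 b3 b2] dist(2) sum(2) S cyc[OF n]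
    by (auto simp: ac_simps anti[of "?w b1 b2 b3"] anti[of "?w b3 b1 b2" "?w b2 b3 b1"])
  ultimately show ?thesis using pappus_structureI[OF n m] by blast
qed

text \<open>Pairing with \<open>p\<close> reads off \<open>D\<close> times the third coordinate, so
  adding a suitable multiple of \<open>cross_prod u v\<close> rescales that coordinate
  alone.\<close>

lemma fn_rescaling:
  assumes "c \<noteq> 0"
  obtains f where "Vector_Spaces.linear (*s) (*s) f" "bij f"
    "\<And>x y z. f (fn x y z) = fn x y (c * z)"
proof -
  define F where "F = (\<lambda>c w. w + ((c - 1) / D * scalar_product p w) *s cross_prod u v)"
  have sp: "scalar_product p (w + w') = scalar_product p w + scalar_product p w'"
    "scalar_product p (k *s w) = k * scalar_product p w" for w w' k
    by (simp_all add: scalar_product_3 algebra_simps)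
  have lin: "Vector_Spaces.linear (*s) (*s) (F c)" for c
    by unfold_locales (simp_all add: F_def vec_eq_iff sp add_divide_distrib diff_divide_distrib algebra_simps)
  \<comment> \<open>Multiplicativity in the scalar makes \<open>F (1 / c)\<close> the inverse of
    \<open>F c\<close>.\<close>
  have FF: "F c (F d w) = F (c * d) w" for c d w
  proof -
    have "scalar_product p (F d w) = d * scalar_product p w"
    proof -
      have "scalar_product p (cross_prod u v) = D"
        by (simp add: scalar_product_3 algebra_simps)
      thus ?thesis using indep by (simp add: F_def sp field_simps)
    qed
    hence "F c (F d w) = F d w + ((c - 1) / D * (d * scalar_product p w)) *s cross_prod u v"
      by (simp add: F_def)
    also have "\<dots> = F (c * d) w"
      by (simp add: F_def vec_eq_iff algebra_simps diff_divide_distrib)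
    finally show ?thesis .
  qed
  have F1: "F 1 w = w" for w by (simp add: F_def)
  have "bij (F c)"
    using assms by (intro o_bij[of "F (1 / c)"]) (simp_all add: fun_eq_iff FF F1)
  moreover have "F c (fn x y z) = fn x y (c * z)" for x y z
  proof -
    have z: "scalar_product p (fn x y z) = D * z" using pt_fn[of 0 0 1 x y z] by (simp add: pt_def)
    have "(c - 1) / D * (D * z) = (c - 1) * z" using indep by simp
    thus ?thesis unfolding F_def z by (simp only:) (simp add: fn_def vec_eq_iff algebra_simps)
  qed
  ultimately show thesis using that lin by blast
qed

lemma leisen_equivalent_steiner:
  assumes A: "A 1 = vec.span {pt 1 0 a1}" "A 2 = vec.span {pt 1 0 a2}" "A 3 = vec.span {pt 1 0 a3}"
    and B: "B 1 = vec.span {pt 0 1 b1}" "B 2 = vec.span {pt 0 1 b2}" "B 3 = vec.span {pt 0 1 b3}"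
    and dist: "distinct [a1, a2, a3]" "distinct [b1, b2, b3]"
    and sum: "a1 + a2 + a3 = 0" "b1 + b2 + b3 = 0" and char: "(2 :: 'a) \<noteq> 0" "(3 :: 'a) \<noteq> 0"
    and S: "a1 * b1 + a2 * b2 + a3 * b3 \<noteq> 0" "a1 * b2 + a2 * b3 + a3 * b1 \<noteq> 0"
      "a1 * b3 + a2 * b1 + a3 * b2 \<noteq> 0" "a1 * b2 + a2 * b1 + a3 * b3 \<noteq> 0"
      "a1 * b3 + a2 * b2 + a3 * b1 \<noteq> 0" "a1 * b1 + a2 * b3 + a3 * b2 \<noteq> 0"
  shows "pappus_equivalent (leisen A B) (steiner A B)"
proof -
  have \<Lambda>: "dual_point (pappus_line A B \<sigma>) = vec.span {line_vec 1 a1 a2 a3 c1 c2 c3}"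
    if "B (\<sigma> 1) = vec.span {pt 0 1 c1}" "B (\<sigma> 2) = vec.span {pt 0 1 c2}"
      "B (\<sigma> 3) = vec.span {pt 0 1 c3}" "distinct [c1, c2, c3]" for \<sigma> c1 c2 c3
    using dual_pappus_line[of A a1 a2 a3 B \<sigma> c1 c2 c3] A that dist(1) by (simp add: line_vec_def)
  have \<Psi>: "dual_point (leisenring_line A (B \<circ> \<sigma>)) = vec.span {line_vec (- 2) a1 a2 a3 c1 c2 c3}"
    if "B (\<sigma> 1) = vec.span {pt 0 1 c1}" "B (\<sigma> 2) = vec.span {pt 0 1 c2}"
      "B (\<sigma> 3) = vec.span {pt 0 1 c3}" "distinct [c1, c2, c3]" "c1 + c2 + c3 = 0" for \<sigma> c1 c2 c3
    using dual_leisenring_line[OF A, of "B \<circ> \<sigma>" c1 c2 c3] that dist(1) sum(1) char(1)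
    by (simp add: line_vec_def)
  have cyc: "cycle_of_list [1, 2, 3] 1 = (2::nat)" "cycle_of_list [1, 2, 3] 2 = (3::nat)"
    "cycle_of_list [1, 2, 3] 3 = (1::nat)" "cycle_of_list [1, 3, 2] 1 = (3::nat)"
    "cycle_of_list [1, 3, 2] 2 = (1::nat)" "cycle_of_list [1, 3, 2] 3 = (2::nat)"
    "cycle_of_list [1, 2] 1 = (2::nat)" "cycle_of_list [1, 2] 2 = (1::nat)"
    "cycle_of_list [1, 2] 3 = (3::nat)" "cycle_of_list [1, 3] 1 = (3::nat)"
    "cycle_of_list [1, 3] 2 = (2::nat)" "cycle_of_list [1, 3] 3 = (1::nat)"
    "cycle_of_list [2, 3] 1 = (1::nat)" "cycle_of_list [2, 3] 2 = (3::nat)"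
    "cycle_of_list [2, 3] 3 = (2::nat)"
    by (simp_all add: transpose_def)
  have perm: "distinct [b2, b3, b1]" "distinct [b3, b1, b2]" "distinct [b2, b1, b3]"
    "distinct [b3, b2, b1]" "distinct [b1, b3, b2]" "b2 + b3 + b1 = 0" "b3 + b1 + b2 = 0"
    "b2 + b1 + b3 = 0" "b3 + b2 + b1 = 0" "b1 + b3 + b2 = 0"
    using dist(2) sum(2) by (auto simp: ac_simps)
  define T where "T = (\<lambda>k.
    {{vec.span {line_vec k a1 a2 a3 b1 b2 b3}, vec.span {line_vec k a1 a2 a3 b2 b3 b1},
      vec.span {line_vec k a1 a2 a3 b3 b1 b2}},
     {vec.span {line_vec k a1 a2 a3 b2 b1 b3}, vec.span {line_vec k a1 a2 a3 b3 b2 b1},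
      vec.span {line_vec k a1 a2 a3 b1 b3 b2}}})"
  have st: "steiner A B = T 1"
    unfolding steiner_def Let_def T_def
    using \<Lambda>[of id b1 b2 b3] \<Lambda>[of "cycle_of_list [1, 2, 3]" b2 b3 b1]
      \<Lambda>[of "cycle_of_list [1, 3, 2]" b3 b1 b2] \<Lambda>[of "cycle_of_list [1, 2]" b2 b1 b3]
      \<Lambda>[of "cycle_of_list [1, 3]" b3 b2 b1] \<Lambda>[of "cycle_of_list [2, 3]" b1 b3 b2]
      B dist(2) perm
    by (simp only: cyc id_apply)
  \<comment> \<open>Here the transpositions come in the order (1 2), (2 3), (1 3), unlike in
    \<open>steiner\<close>; \<open>insert_commute\<close> reconciles the two.\<close>
  have le: "leisen A B = T (- 2)"
    unfolding leisen_def Let_def T_def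
    using \<Psi>[of id b1 b2 b3] \<Psi>[of "cycle_of_list [1, 2, 3]" b2 b3 b1]
      \<Psi>[of "cycle_of_list [1, 3, 2]" b3 b1 b2] \<Psi>[of "cycle_of_list [1, 2]" b2 b1 b3]
      \<Psi>[of "cycle_of_list [1, 3]" b3 b2 b1] \<Psi>[of "cycle_of_list [2, 3]" b1 b3 b2]
      B dist(2) sum(2) perm
    by (simp only: cyc id_apply insert_commute)
  have "pappus_structure (T k)" if "k \<noteq> 0" for k
    unfolding T_def using pappus_structure_line_vec[OF dist sum char(2) that S] .
  hence pap: "pappus_structure (T 1)" "pappus_structure (T (- 2))"
    using char(1) by simp_all
  have "- 2 \<noteq> (0 :: 'a)" using char(1) by simp
  then obtain f where f: "Vector_Spaces.linear (*s) (*s) f" "bij f"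
    "\<And>x y z. f (fn x y z) = fn x y (- 2 * z)"
    using fn_rescaling by blast
  have "f ` vec.span {line_vec (- 2) a1 a2 a3 c1 c2 c3} = vec.span {line_vec 1 a1 a2 a3 c1 c2 c3}" for c1 c2 c3
  proof -
    \<comment> \<open>Scaling the third coordinate by -2 as well makes -2 a common factor, which is
      invisible projectively.\<close>
    have "f (line_vec (- 2) a1 a2 a3 c1 c2 c3) = (- 2) *s line_vec 1 a1 a2 a3 c1 c2 c3"
      unfolding line_vec_def f(3) by (simp add: fn_def vec_eq_iff algebra_simps)
    thus ?thesis
      using vec.linear_span_image[OF f(1), of "{line_vec (- 2) a1 a2 a3 c1 c2 c3}"]
        span_scale[OF \<open>- 2 \<noteq> (0 :: 'a)\<close>, of "line_vec 1 a1 a2 a3 c1 c2 c3"] by simp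
  qed
  hence "T 1 = (\<lambda>T. (\<lambda>q. f ` q) ` T) ` T (- 2)" by (simp add: T_def)
  thus ?thesis unfolding pappus_equivalent_def st le using pap f(1,2) by blast
qed

end

section \<open>From the labelled points to a frame\<close>

theorem theorem6p1:
  fixes A B :: "nat \<Rightarrow> ('a::field ^ 3) set" and x y :: 'a
  assumes "CHAR('a) \<noteq> 2" and "CHAR('a) \<noteq> 3"
    and "pappus_structure {{A 1, A 2, A 3}, {B 1, B 2, B 3}}"
    and "sig A B = (x, y)"
    and "x \<noteq> y"
  shows "pappus_structure (leisen A B) \<and> pappus_equivalent (leisen A B) (steiner A B)"
proof -
  \<comment> \<open>The characteristic is never 1, so it divides a prime only by being equal to
    it.\<close>
  have nz: "(of_nat q :: 'a) \<noteq> 0" if "prime q" "CHAR('a) \<noteq> q" for q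
    using that CHAR_not_1[where 'a = 'a] by (auto simp: of_nat_eq_0_iff_char_dvd prime_nat_iff)
  have char: "(2 :: 'a) \<noteq> 0" "(3 :: 'a) \<noteq> 0"
    using nz[of 2] nz[of 3] assms(1,2) by simp_all
  obtain L M where L: "proj_line L" "\<And>q. q \<in> {A 1, A 2, A 3} \<Longrightarrow> proj_point q \<and> q \<subseteq> L \<and> q \<noteq> L \<inter> M"
    and M: "proj_line M" "\<And>q. q \<in> {B 1, B 2, B 3} \<Longrightarrow> proj_point q \<and> q \<subseteq> M \<and> q \<noteq> L \<inter> M"
    and ne: "L \<noteq> M" "distinct [A 1, A 2, A 3]" "distinct [B 1, B 2, B 3]"
    using pappus_structure_labelledE[OF assms(3)] by metis
  obtain p where p: "p \<noteq> 0" "L \<inter> M = vec.span {p}" using proj_lines_meet L(1) M(1) ne(1) by blast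
  have pLM: "p \<in> L" "p \<in> M" using p(2) vec.span_base[of p "{p}"] by auto
  obtain u a1 a2 a3 where u: "cross_prod u p \<noteq> 0" "u \<in> L"
    and a: "distinct [a1, a2, a3]" "a1 + a2 + a3 = 0"
    and A: "A 1 = vec.span {u + a1 *s p}" "A 2 = vec.span {u + a2 *s p}" "A 3 = vec.span {u + a3 *s p}"
    using line_coordinates[OF L[unfolded p(2)] ne(2) p(1) pLM(1) char(2)] by metis
  obtain v b1 b2 b3 where v: "cross_prod v p \<noteq> 0" "v \<in> M"
    and b: "distinct [b1, b2, b3]" "b1 + b2 + b3 = 0"
    and B: "B 1 = vec.span {v + b1 *s p}" "B 2 = vec.span {v + b2 *s p}" "B 3 = vec.span {v + b3 *s p}"
    using line_coordinates[OF M[unfolded p(2)] ne(3) p(1) pLM(2) char(2)] by metis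
  interpret frame u v p
  proof
    show "scalar_product (cross_prod u v) p \<noteq> 0"
    proof
      \<comment> \<open>Then \<open>v\<close> lies in the span of \<open>u\<close> and
        \<open>p\<close>, that is in \<open>L\<close>, and both lines equal the span of
        \<open>v\<close> and \<open>p\<close>.\<close>
      assume "scalar_product (cross_prod u v) p = 0"
      hence "v \<in> orth (cross_prod u p)"
        unfolding orth_def by (simp add: scalar_product_3) algebra
      hence "v \<in> L"
        using proj_line_eq_span[OF L(1) u(2) pLM(1) u(1)] span_pair_eq_orth[OF u(1)] by simp
      thus False
        using proj_line_eq_span[OF L(1) _ pLM(1) v(1)] proj_line_eq_span[OF M(1) v(2) pLM(2) v(1)] ne(1)
        by simp
    qed
  qed
  have A': "A 1 = vec.span {pt 1 0 a1}" "A 2 = vec.span {pt 1 0 a2}" "A 3 = vec.span {pt 1 0 a3}"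
    and B': "B 1 = vec.span {pt 0 1 b1}" "B 2 = vec.span {pt 0 1 b2}" "B 3 = vec.span {pt 0 1 b3}"
    by (simp_all add: A B pt_def del: One_nat_def)
  have C: "center A B = vec.span {p}"
    using center_eq[OF A'(1,2) B'(1,2)] a(1) b(1) by (simp add: pt_def)
  have r: "cross_ratio (A 1) (A 2) (A 3) (center A B) = (a1 - a3) / (a2 - a3)"
    unfolding A C using a(1) u(1) by (intro cross_ratio_affine) auto
  have s: "cross_ratio (B 1) (B 2) (B 3) (center A B) = (b1 - b3) / (b2 - b3)"
    unfolding B C using b(1) v(1) by (intro cross_ratio_affine) auto
  have "j_fun ((a1 - a3) / (a2 - a3)) + j_fun ((b1 - b3) / (b2 - b3)) \<noteq>
    j_fun ((a1 - a3) / (a2 - a3)) * j_fun ((b1 - b3) / (b2 - b3))"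
    using assms(4,5) unfolding sig_def r s Let_def by simp
  note S = inner_products_nonzero[OF a(1) b(1) a(2) b(2) char(2) refl refl this]
  have "pappus_equivalent (leisen A B) (steiner A B)"
    by (rule leisen_equivalent_steiner[OF A' B' a(1) b(1) a(2) b(2) char S])
  thus ?thesis by (simp add: pappus_equivalent_def)
qed

end
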